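(* Let $P$ be a self-dual poset and let $\mathcal{O}$ be a swap-closed promotion orbit of elements of $\mathrm{Inc}^q(P)$. Then, $\mathcal{O}$ exhibits orbitmesy with respect to the antipodal sum statistic $\mathcal{A}_x$ for all $x \in P$ and with respect to the total sum statistic $\mathrm{Tot}$.
   Context: $P$ is a finite self-dual poset with a fixed order-reversing involution $\kappa:P\to P$. $\mathrm{Inc}^q(P)$ is the set of increasing labelings $f:P\to[q]$ ($f(x)<f(y)$ whenever $x<y$). Promotion $\mathrm{Pro}$ on $\mathrm{Inc}^q(P)$: replace every label $1$ by an empty box; for $i=2,\dots,q$ in turn slide boxes up (a box at $x$ becomes $i$ if some $y\gtrdot x$ is labeled $i$, and that element labeled $i$ becomes a box); then replace boxes by $q+1$ and subtract $1$ from every label. $\mathrm{swap}(f)(x)=q+1-f(\kappa(x))$; swap sends each promotion orbit onto a single promotion orbit, and an orbit $\mathcal{O}$ is swap-closed if $\mathrm{swap}(\mathcal{O})=\mathcal{O}$. $\mathcal{A}_x(f)=f(x)+f(\kappa(x))$ and $\mathrm{Tot}(f)=\sum_{x\in P}f(x)$. An orbit is orbitmesic with respect to a statistic if its average value of the statistic equals the average over all of $\mathrm{Inc}^q(P)$. *)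

theory Defs
  imports Complex_Main "HOL-Library.FuncSet" "HOL-Combinatorics.Orbits"
begin

text \<open>
  A finite poset is a finite subset \<open>P\<close> of a partially ordered type, with the induced order. Every
  finite poset arises this way (embed it into a powerset by principal down-sets), including the
  empty one. Labelings are extensional functions on \<open>P\<close>, so that equality of labelings is equality
  on \<open>P\<close> and the set of all increasing labelings is finite.
\<close>

definition order_reversing_involution :: "'a::order set \<Rightarrow> ('a \<Rightarrow> 'a) \<Rightarrow> bool" where
  "order_reversing_involution P \<kappa> \<longleftrightarrow>
     \<kappa> \<in> P \<rightarrow> P \<and> antimono_on P \<kappa> \<and> (\<forall>x\<in>P. \<kappa> (\<kappa> x) = x)"

definition Inc :: "'a::order set \<Rightarrow> nat \<Rightarrow> ('a \<Rightarrow> nat) set" where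
  "Inc P q = {f \<in> P \<rightarrow>\<^sub>E {1..q}. strict_mono_on P f}"

definition covers :: "'a::order set \<Rightarrow> 'a \<Rightarrow> 'a \<Rightarrow> bool" where
  "covers P y x \<longleftrightarrow> x \<in> P \<and> y \<in> P \<and> x < y \<and> \<not> (\<exists>z\<in>P. x < z \<and> z < y)"

text \<open>
  In a partially filled labeling the value \<open>None\<close> is an empty box. One slide acts on all elements
  simultaneously: both conditions refer to the labeling \<open>g\<close> before the slide.
\<close>

definition slide :: "'a::order set \<Rightarrow> nat \<Rightarrow> ('a \<Rightarrow> nat option) \<Rightarrow> 'a \<Rightarrow> nat option" where
  "slide P i g x =
     (if g x = None \<and> (\<exists>y. covers P y x \<and> g y = Some i) then Some i
      else if g x = Some i \<and> (\<exists>z. covers P x z \<and> g z = None) then None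
      else g x)"

definition empty_ones :: "('a \<Rightarrow> nat) \<Rightarrow> 'a \<Rightarrow> nat option" where
  "empty_ones f x = (if f x = 1 then None else Some (f x))"

definition fill_boxes :: "nat \<Rightarrow> ('a \<Rightarrow> nat option) \<Rightarrow> 'a \<Rightarrow> nat" where
  "fill_boxes m g x = (case g x of None \<Rightarrow> m | Some i \<Rightarrow> i)"

definition Pro :: "'a::order set \<Rightarrow> nat \<Rightarrow> ('a \<Rightarrow> nat) \<Rightarrow> 'a \<Rightarrow> nat" where
  "Pro P q f = (\<lambda>x\<in>P. fill_boxes (q + 1) (fold (slide P) [2..<q + 1] (empty_ones f)) x - 1)"

text \<open>
  The library's \<open>orbit\<close> consists of the iterates with positive exponent. Promotion permutes the
  finite set of increasing labelings, so this is the usual orbit, and it contains \<open>f\<close>.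
\<close>

definition promotion_orbit :: "'a::order set \<Rightarrow> nat \<Rightarrow> ('a \<Rightarrow> nat) set \<Rightarrow> bool" where
  "promotion_orbit P q Orb \<longleftrightarrow> (\<exists>f \<in> Inc P q. Orb = orbit (Pro P q) f)"

definition swap :: "'a set \<Rightarrow> ('a \<Rightarrow> 'a) \<Rightarrow> nat \<Rightarrow> ('a \<Rightarrow> nat) \<Rightarrow> 'a \<Rightarrow> nat" where
  "swap P \<kappa> q f = (\<lambda>x\<in>P. q + 1 - f (\<kappa> x))"

definition swap_closed :: "'a set \<Rightarrow> ('a \<Rightarrow> 'a) \<Rightarrow> nat \<Rightarrow> ('a \<Rightarrow> nat) set \<Rightarrow> bool" where
  "swap_closed P \<kappa> q Orb \<longleftrightarrow> swap P \<kappa> q ` Orb = Orb"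

definition antipodal_sum :: "('a \<Rightarrow> 'a) \<Rightarrow> 'a \<Rightarrow> ('a \<Rightarrow> nat) \<Rightarrow> nat" where
  "antipodal_sum \<kappa> x f = f x + f (\<kappa> x)"

definition Tot :: "'a set \<Rightarrow> ('a \<Rightarrow> nat) \<Rightarrow> nat" where
  "Tot P f = (\<Sum>x\<in>P. f x)"

definition average :: "'b set \<Rightarrow> ('b \<Rightarrow> nat) \<Rightarrow> real" where
  "average S st = (\<Sum>s\<in>S. real (st s)) / real (card S)"

definition orbitmesic ::
    "'a::order set \<Rightarrow> nat \<Rightarrow> ('a \<Rightarrow> nat) set \<Rightarrow> (('a \<Rightarrow> nat) \<Rightarrow> nat) \<Rightarrow> bool" where
  "orbitmesic P q Orb st \<longleftrightarrow> average Orb st = average (Inc P q) st"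

end

theory Submission
  imports Defs
begin

text \<open>
  On any finite swap-closed set of labelings with values in \<open>{..q}\<close>, reindexing along \<open>swap\<close> shows
  that \<open>f x\<close> and \<open>q + 1 - f (\<kappa> x)\<close> have the same sum, so the antipodal sum averages to \<open>q + 1\<close>; summing
  over \<open>P\<close> gives twice the total sum. Both \<open>Inc\<close> and a swap-closed orbit are such sets. For the orbit,
  only the upper bound \<open>q\<close> on the labels matters, and every single step of promotion visibly
  preserves it, so one need not show that promotion preserves increasing labelings.
\<close>

text \<open>A slide changes an entry only to \<open>i\<close> or to an empty box, and the latter is
  read as \<open>m\<close>; neither exceeds \<open>m\<close>.\<close>

lemma fill_boxes_le_slide:
  assumes "\<And>x. x \<in> P \<Longrightarrow> fill_boxes m g x \<le> m" and "i \<le> m" and "x \<in> P"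
  shows "fill_boxes m (slide P i g) x \<le> m"
  using assms(1)[OF assms(3)] assms(2) by (auto simp: slide_def fill_boxes_def)

lemma fill_boxes_le_fold_slide:
  assumes "\<And>i. i \<in> set is \<Longrightarrow> i \<le> m"
    and "\<And>x. x \<in> P \<Longrightarrow> fill_boxes m g x \<le> m" and "x \<in> P"
  shows "fill_boxes m (fold (slide P) is g) x \<le> m"
  using assms
proof (induction "is" arbitrary: g x)
  case (Cons i "is")
  have "fill_boxes m (slide P i g) y \<le> m" if "y \<in> P" for y
    using Cons.prems that by (intro fill_boxes_le_slide) auto
  hence "fill_boxes m (fold (slide P) is (slide P i g)) x \<le> m"
    using Cons.prems by (intro Cons.IH) simp_all
  thus ?case by simp
qed simp

lemma Pro_bounded:
  assumes "f \<in> P \<rightarrow>\<^sub>E {..q}"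
  shows "Pro P q f \<in> P \<rightarrow>\<^sub>E {..q}"
proof -
  have "fill_boxes (q + 1) (empty_ones f) x \<le> q + 1" if "x \<in> P" for x
    using PiE_mem[OF assms that] by (auto simp: fill_boxes_def empty_ones_def)
  hence "fill_boxes (q + 1) (fold (slide P) [2..<q + 1] (empty_ones f)) x \<le> q + 1"
    if "x \<in> P" for x
    using that by (intro fill_boxes_le_fold_slide) auto
  \<comment> \<open>Boxes are filled with \<open>q + 1\<close>, so labels reach at most
    \<open>q + 1\<close>, and the final subtraction of 1 restores the bound
    \<open>q\<close>.\<close>
  thus ?thesis by (simp add: Pro_def le_diff_conv)
qed

lemma orbit_Pro_bounded:
  assumes "f \<in> P \<rightarrow>\<^sub>E {..q}"
  shows "orbit (Pro P q) f \<subseteq> P \<rightarrow>\<^sub>E {..q}"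
proof
  fix g assume "g \<in> orbit (Pro P q) f"
  \<comment> \<open>The base element of \<open>orbit\<close> is \<open>Pro P q f\<close>, not
    \<open>f\<close>, so the base case also takes one promotion step.\<close>
  thus "g \<in> P \<rightarrow>\<^sub>E {..q}" by induction (rule Pro_bounded, rule assms, rule Pro_bounded)
qed

lemma Inc_bounded: "Inc P q \<subseteq> P \<rightarrow>\<^sub>E {..q}"
  using PiE_mono[of P "\<lambda>_. {1..q}" "\<lambda>_. {..q}"] by (auto simp: Inc_def)

text \<open>Antitonicity gives only the weak inequality; strictness comes from injectivity of
  \<open>\<kappa>\<close>, which is its own inverse on \<open>P\<close>.\<close>

lemma order_reversing_involution_less:
  assumes "order_reversing_involution P \<kappa>" and "x \<in> P" "y \<in> P" "x < y"
  shows "\<kappa> y < \<kappa> x"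
proof -
  have "\<kappa> y \<le> \<kappa> x"
    using assms by (auto simp: order_reversing_involution_def monotone_on_def)
  moreover have "\<kappa> y \<noteq> \<kappa> x"
    using assms unfolding order_reversing_involution_def by (metis order_less_irrefl)
  ultimately show ?thesis by simp
qed

lemma order_reversing_involution_bij_betw:
  assumes "order_reversing_involution P \<kappa>"
  shows "bij_betw \<kappa> P P"
  using assms unfolding order_reversing_involution_def
  by (intro bij_betw_byWitness[where f' = \<kappa>]) auto

text \<open>The bound \<open>q\<close> keeps the truncated subtraction from losing information, and
  extensionality settles the points outside \<open>P\<close>.\<close>

lemma swap_swap:
  assumes "order_reversing_involution P \<kappa>" and "f \<in> P \<rightarrow>\<^sub>E {..q}"
  shows "swap P \<kappa> q (swap P \<kappa> q f) = f"
proof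
  fix x
  show "swap P \<kappa> q (swap P \<kappa> q f) x = f x"
  proof (cases "x \<in> P")
    case True
    then have "\<kappa> x \<in> P" "\<kappa> (\<kappa> x) = x" "f x \<le> q"
      using assms by (auto simp: order_reversing_involution_def)
    thus ?thesis using True by (simp add: swap_def)
  next
    case False
    thus ?thesis using PiE_arb[OF assms(2)] by (simp add: swap_def)
  qed
qed

lemma swap_Inc:
  assumes "order_reversing_involution P \<kappa>" and "f \<in> Inc P q"
  shows "swap P \<kappa> q f \<in> Inc P q"
proof -
  have \<kappa>: "\<kappa> x \<in> P" if "x \<in> P" for x
    using assms(1) that by (auto simp: order_reversing_involution_def)
  have f: "f x \<in> {1..q}" if "x \<in> P" for x
    using assms(2) that by (auto simp: Inc_def)
  have "f (\<kappa> y) < f (\<kappa> x)" if "x \<in> P" "y \<in> P" "x < y" for x y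
    using assms(2) order_reversing_involution_less[OF assms(1) that] that \<kappa>
    by (auto simp: Inc_def monotone_on_def)
  hence "strict_mono_on P (swap P \<kappa> q f)"
    \<comment> \<open>Two reversals compose to a strictly increasing map; complementing is strictly
      decreasing here since \<open>f (\<kappa> y) < q + 1\<close>.\<close>
    using f[OF \<kappa>] by (intro strict_mono_onI) (simp add: swap_def diff_less_mono2 less_Suc_eq_le)
  moreover have "q + 1 - f (\<kappa> x) \<in> {1..q}" if "x \<in> P" for x
    using f[OF \<kappa>[OF that]] by auto
  hence "swap P \<kappa> q f \<in> P \<rightarrow>\<^sub>E {1..q}" by (simp add: swap_def)
  ultimately show ?thesis by (simp add: Inc_def)
qed

lemma swap_closed_Inc:
  assumes "order_reversing_involution P \<kappa>"
  shows "swap_closed P \<kappa> q (Inc P q)"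
  unfolding swap_closed_def
proof
  show "swap P \<kappa> q ` Inc P q \<subseteq> Inc P q" using swap_Inc[OF assms] by blast
  show "Inc P q \<subseteq> swap P \<kappa> q ` Inc P q"
  proof
    fix f assume f: "f \<in> Inc P q"
    have "f = swap P \<kappa> q (swap P \<kappa> q f)"
      using swap_swap[OF assms subsetD[OF Inc_bounded f]] by simp
    thus "f \<in> swap P \<kappa> q ` Inc P q" using swap_Inc[OF assms f] by blast
  qed
qed

lemma sum_antipodal_sum_swap_closed:
  assumes "order_reversing_involution P \<kappa>" and "S \<subseteq> P \<rightarrow>\<^sub>E {..q}"
    and "swap_closed P \<kappa> q S" and "x \<in> P"
  shows "(\<Sum>f\<in>S. antipodal_sum \<kappa> x f) = card S * (q + 1)"
proof -
  \<comment> \<open>Being its own left inverse on bounded labelings, \<open>swap\<close> is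
    injective on \<open>S\<close>; with closure it permutes \<open>S\<close>, which allows
    reindexing.\<close>
  have "inj_on (swap P \<kappa> q) S"
    using swap_swap[OF assms(1)] assms(2) by (intro inj_on_inverseI[where g = "swap P \<kappa> q"]) blast
  hence "bij_betw (swap P \<kappa> q) S S"
    using assms(3) by (simp add: bij_betw_def swap_closed_def)
  hence "(\<Sum>f\<in>S. f x) = (\<Sum>f\<in>S. swap P \<kappa> q f x)"
    by (rule sum.reindex_bij_betw[symmetric])
  hence "(\<Sum>f\<in>S. antipodal_sum \<kappa> x f) = (\<Sum>f\<in>S. swap P \<kappa> q f x + f (\<kappa> x))"
    by (simp add: antipodal_sum_def sum.distrib)
  also have "\<dots> = (\<Sum>f\<in>S. q + 1)"
  proof (rule sum.cong)
    fix f assume "f \<in> S"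
    moreover have "\<kappa> x \<in> P" using assms by (auto simp: order_reversing_involution_def)
    \<comment> \<open>With this bound the subtraction in \<open>swap\<close> does not truncate, so
      the two terms add up to exactly \<open>q + 1\<close>.\<close>
    ultimately have "f (\<kappa> x) \<le> q" using assms(2) by auto
    thus "swap P \<kappa> q f x + f (\<kappa> x) = q + 1" using assms(4) by (simp add: swap_def)
  qed simp
  finally show ?thesis by simp
qed

text \<open>Since \<open>\<kappa>\<close> permutes \<open>P\<close>, both summands of the antipodal
  sum contribute \<open>Tot P f\<close>.\<close>

lemma sum_antipodal_sum:
  assumes "order_reversing_involution P \<kappa>"
  shows "(\<Sum>x\<in>P. antipodal_sum \<kappa> x f) = 2 * Tot P f"
  using sum.reindex_bij_betw[OF order_reversing_involution_bij_betw[OF assms], of f]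
  by (simp add: antipodal_sum_def Tot_def sum.distrib)

lemma average_antipodal_sum:
  assumes "order_reversing_involution P \<kappa>" and "S \<subseteq> P \<rightarrow>\<^sub>E {..q}"
    and "swap_closed P \<kappa> q S" and "finite S" "S \<noteq> {}" and "x \<in> P"
  shows "average S (antipodal_sum \<kappa> x) = real (q + 1)"
proof -
  have "(\<Sum>f\<in>S. real (antipodal_sum \<kappa> x f)) = real (card S * (q + 1))"
    unfolding sum_antipodal_sum_swap_closed[OF assms(1-3,6), symmetric] by simp
  moreover have "card S \<noteq> 0" using assms(4,5) by simp
  ultimately show ?thesis by (simp only: average_def of_nat_mult) simp
qed

text \<open>Double counting: the sum of all antipodal sums over \<open>S\<close> and
  \<open>P\<close> is evaluated in both orders, giving a value independent of
  \<open>S\<close>.\<close>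

lemma average_Tot:
  assumes "order_reversing_involution P \<kappa>" and "S \<subseteq> P \<rightarrow>\<^sub>E {..q}"
    and "swap_closed P \<kappa> q S" and "finite S" "S \<noteq> {}"
  shows "average S (Tot P) = real (card P) * real (q + 1) / 2"
proof -
  have "2 * (\<Sum>f\<in>S. Tot P f) = (\<Sum>f\<in>S. \<Sum>x\<in>P. antipodal_sum \<kappa> x f)"
    by (simp add: sum_antipodal_sum[OF assms(1)] sum_distrib_left)
  also have "\<dots> = (\<Sum>x\<in>P. \<Sum>f\<in>S. antipodal_sum \<kappa> x f)"
    by (rule sum.swap)
  also have "\<dots> = card P * (card S * (q + 1))"
    by (simp add: sum_antipodal_sum_swap_closed[OF assms(1-3)])
  finally have "real (2 * (\<Sum>f\<in>S. Tot P f)) = real (card P * (card S * (q + 1)))"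
    by (rule arg_cong)
  hence "2 * (\<Sum>f\<in>S. real (Tot P f)) = real (card P) * (real (card S) * real (q + 1))"
    by (simp only: of_nat_mult of_nat_sum of_nat_numeral)
  moreover have "card S \<noteq> 0" using assms(4,5) by simp
  ultimately show ?thesis by (simp add: average_def field_simps)
qed

theorem theorem5p14:
  fixes P :: "'a::order set" and \<kappa> :: "'a \<Rightarrow> 'a" and q :: nat and Orb :: "('a \<Rightarrow> nat) set"
  assumes "finite P"
    and "order_reversing_involution P \<kappa>"
    and "promotion_orbit P q Orb"
    and "swap_closed P \<kappa> q Orb"
  shows "(\<forall>x\<in>P. orbitmesic P q Orb (antipodal_sum \<kappa> x)) \<and> orbitmesic P q Orb (Tot P)"
proof -
  obtain f where f: "f \<in> Inc P q" and Orb: "Orb = orbit (Pro P q) f"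
    using assms(3) by (auto simp: promotion_orbit_def)
  have fin: "finite S" if "S \<subseteq> P \<rightarrow>\<^sub>E {..q}" for S
    using that finite_PiE[OF assms(1), of "\<lambda>_. {..q}"] finite_subset by blast
  have Orb_bounded: "Orb \<subseteq> P \<rightarrow>\<^sub>E {..q}"
    unfolding Orb using f Inc_bounded by (intro orbit_Pro_bounded) blast
  \<comment> \<open>The witness is \<open>Pro P q f\<close>, so it need not be known that
    \<open>f\<close> lies in its own orbit.\<close>
  have "Orb \<noteq> {}" unfolding Orb using orbit.base by fast
  note Orb_facts = assms(2) Orb_bounded assms(4) fin[OF Orb_bounded] this
  have "Inc P q \<noteq> {}" using f by blast
  note Inc_facts = assms(2) Inc_bounded swap_closed_Inc[OF assms(2)] fin[OF Inc_bounded] this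
  \<comment> \<open>Both averages equal the same expression in \<open>q\<close> and
    \<open>card P\<close>, once for \<open>Orb\<close> and once for \<open>Inc P q\<close>.\<close>
  show ?thesis
    by (simp add: orbitmesic_def average_antipodal_sum[OF Orb_facts]
        average_antipodal_sum[OF Inc_facts] average_Tot[OF Orb_facts] average_Tot[OF Inc_facts])
qed

end
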